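(* Let the data $X,K,X_j,\gamma_j,A,Y,\varphi,j,f,R,q,a_S$ satisfy the standing assumptions listed in the context, assume $\alpha_\varphi+\alpha_jc_j^2<m_A$, and let $j_c:X_j\to X_j^*$ be a linear operator such that $\|j_c(z)\|_{X_j^*}\le\alpha_c\|z\|_{X_j}$ and $\langle j_c(z),z\rangle_{X_j}\ge\alpha_j\|z\|_{X_j}^2$ for all $z\in X_j$. Let $T>0$, $N$ a positive integer, $k=T/N$ and $1\le n\le N$. Let $u_0^k,\dots,u_{n-1}^k\in K$ be given, and let $u_n^k\in K$ be the solution of $$\langle Au_n^k,v-u_n^k\rangle+\varphi(\mathcal S_{n,L}^ku^k,u_n^k,v)-\varphi(\mathcal S_{n,L}^ku^k,u_n^k,u_n^k)+j^0(\gamma_ju_n^k;\gamma_jv-\gamma_ju_n^k)\ge\langle f_n,v-u_n^k\rangle\quad\forall v\in K.$$ Let $\tilde u_{n,0}^k\in K$ and let $\{\tilde u_{n,i}^k\}_{i\ge1}\subset K$ satisfy, for every $i\ge1$ and every $v\in K$, $$\langle A\tilde u_{n,i}^k,v-\tilde u_{n,i}^k\rangle+\varphi(\mathcal S_{n,L}^ku^k,\tilde u_{n,i-1}^k,v)-\varphi(\mathcal S_{n,L}^ku^k,\tilde u_{n,i-1}^k,\tilde u_{n,i}^k)+j^0(\gamma_j\tilde u_{n,i}^k;\gamma_jv-\gamma_j\tilde u_{n,i}^k)$$ $$+\langle j_c(\gamma_j\tilde u_{n,i}^k),\gamma_jv-\gamma_j\tilde u_{n,i}^k\rangle_{X_j}\ge\langle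 f_n,v-\tilde u_{n,i}^k\rangle+\langle j_c(\gamma_j\tilde u_{n,i-1}^k),\gamma_jv-\gamma_j\tilde u_{n,i}^k\rangle_{X_j}.$$ Then the iteration converges linearly: $\tilde u_{n,i}^k\to u_n^k$ in $X$ as $i\to\infty$, linearly with the convergence rate $\rho=(\alpha_\varphi+\alpha_cc_j^2)/m_A$, which is independent of the time step-size $k$.
   Context: Notation. All spaces are real. $\mathbb R_+=[0,\infty)$; $X^*,X_j^*$ are topological duals; $\langle\cdot,\cdot\rangle$ is the duality pairing between $X^*$ and $X$, $\langle\cdot,\cdot\rangle_{X_j}$ the one between $X_j^*$ and $X_j$; $\mathcal L(\cdot;\cdot)$ denotes bounded linear operators, $\mathcal L(X)=\mathcal L(X;X)$. For a locally Lipschitz $j:X_j\to\mathbb R$, the Clarke directional derivative is $j^0(x;v)=\limsup_{y\to x,\lambda\downarrow0}\frac{j(y+\lambda v)-j(y)}{\lambda}$ and $\partial j(x)=\{\xi\in X_j^*: j^0(x;v)\ge\langle\xi,v\rangle_{X_j}\ \forall v\in X_j\}$. Standing assumptions on the data. $X$ is a reflexive Banach space, $K\subset X$ is closed and convex, $0\in K$. $X_j$ is a Banach space, $\gamma_j\in\mathcal L(X;X_j)$ and $c_j>0$ satisfies $\|\gamma_jv\|_{X_j}\le c_j\|v\|_X$ for all $v\in X$. $A:X\to X^*$ is Lipschitz continuous with constant $L_A>0$ and strongly monotone: $\langle Av_1-Av_2,v_1-v_2\rangle\ge m_A\|v_1-v_2\|_X^2$ for all $v_1,v_2\in X$, with $m_A>0$.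 $Y$ is a normed space and $\varphi:Y\times K\times K\to\mathbb R$ is such that $\varphi(y,u,\cdot)$ is convex and lower semicontinuous on $K$ for all $y\in Y,u\in K$, and there are $\alpha_\varphi>0,\beta_\varphi>0$ with $\varphi(y_1,u_1,v_2)-\varphi(y_1,u_1,v_1)+\varphi(y_2,u_2,v_1)-\varphi(y_2,u_2,v_2)\le\alpha_\varphi\|u_1-u_2\|_X\|v_1-v_2\|_X+\beta_\varphi\|y_1-y_2\|_Y\|v_1-v_2\|_X$ for all $y_1,y_2\in Y$, $u_1,u_2,v_1,v_2\in K$. The function $j:X_j\to\mathbb R$ is locally Lipschitz; there are $c_0,c_1\ge0$ with $\|\xi\|_{X_j^*}\le c_0+c_1\|z\|_{X_j}$ for all $z\in X_j$, $\xi\in\partial j(z)$; there is $\alpha_j>0$ with $j^0(z_1;z_2-z_1)+j^0(z_2;z_1-z_2)\le\alpha_j\|z_1-z_2\|_{X_j}^2$ for all $z_1,z_2\in X_j$. $f\in C(\mathbb R_+;X^* )$. $R\in\mathcal L(X;Y)$, $q\in C(\mathbb R_+\times\mathbb R_+;\mathcal L(X))$, $a_S\in X$; these define the history-dependent operator $(\mathcal Sv)(t)=R\left(\int_0^tq(t,s)v(s)\,ds+a_S\right)$ for $v\in C(\mathbb R_+;X)$, of which $\mathcal S_{n,L}^k$ below is a discretization. Time discretization. $t_n=nk$, $0\le n\le N$, $f_n=f(t_n)$. For $n\ge1$, $\mathcal S_{n,L}^ku^k=R\left(\frac k2q(t_n,t_0)u_0^k+k\sum_{i=1}^{n-1}q(t_n,t_i)u_i^k+\frac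 k2q(t_n,t_{n-1})u_{n-1}^k+a_S\right)$ (empty sum $=0$), which depends only on $u_0^k,\dots,u_{n-1}^k$.
   Formalization: The estimate ‖ũ_i−u_n‖ ≤ ρ‖ũ_{i−1}−u_n‖ is proved always, but the limit ũ_i→u_n only if ρ<1, which the stated smallness condition does not imply (the iteration can diverge otherwise); α_c≥0 is assumed, automatic unless X_j={0}. *)

theory Defs
  imports "HOL-Analysis.Analysis"
begin

text \<open>
  The topological dual of a real normed space \<open>'a\<close> is the type \<open>'a \<Rightarrow>\<^sub>L real\<close> of bounded linear
  functionals with the operator norm, and the duality pairing of \<open>\<xi>\<close> and \<open>x\<close> is the application
  \<open>blinfun_apply \<xi> x\<close>.
\<close>

definition reflexive_space :: "'a::real_normed_vector itself \<Rightarrow> bool" where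
  "reflexive_space _ \<longleftrightarrow>
    (\<forall>\<Phi> :: ('a \<Rightarrow>\<^sub>L real) \<Rightarrow>\<^sub>L real. \<exists>x :: 'a. \<forall>\<xi> :: 'a \<Rightarrow>\<^sub>L real.
      blinfun_apply \<Phi> \<xi> = blinfun_apply \<xi> x)"

definition lsc_on :: "'a::topological_space set \<Rightarrow> ('a \<Rightarrow> real) \<Rightarrow> bool" where
  "lsc_on S g \<longleftrightarrow> (\<forall>x\<in>S. \<forall>c < g x. \<forall>\<^sub>F y in at x within S. c < g y)"

definition locally_lipschitz :: "('a::metric_space \<Rightarrow> 'b::metric_space) \<Rightarrow> bool" where
  "locally_lipschitz g \<longleftrightarrow> (\<forall>x. \<exists>r>0. \<exists>L. L-lipschitz_on (ball x r) g)"

text \<open>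
  The upper limit is taken in the extended reals, with \<open>y\<close> allowed to equal \<open>x\<close>. The conversion
  back to a real is only meaningful for a finite upper limit; for locally Lipschitz \<open>j\<close> this is
  the lemma \<open>clarke_deriv_finite\<close>.
\<close>

definition clarke_deriv :: "('a::real_normed_vector \<Rightarrow> real) \<Rightarrow> 'a \<Rightarrow> 'a \<Rightarrow> real" where
  "clarke_deriv j x v =
    real_of_ereal (Limsup (nhds x \<times>\<^sub>F at_right 0)
      (\<lambda>(y, l). ereal ((j (y + l *\<^sub>R v) - j y) / l)))"

definition clarke_subdiff :: "('a::real_normed_vector \<Rightarrow> real) \<Rightarrow> 'a \<Rightarrow> ('a \<Rightarrow>\<^sub>L real) set" where
  "clarke_subdiff j x = {\<xi>. \<forall>v. clarke_deriv j x v \<ge> blinfun_apply \<xi> v}"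

lemma clarke_deriv_finite:
  assumes "locally_lipschitz j"
  shows "ereal (clarke_deriv j x v) =
    Limsup (nhds x \<times>\<^sub>F at_right 0) (\<lambda>(y, l). ereal ((j (y + l *\<^sub>R v) - j y) / l))"
proof -
  let ?F = "nhds x \<times>\<^sub>F at_right (0::real)"
  let ?q = "\<lambda>(y, l). ereal ((j (y + l *\<^sub>R v) - j y) / l)"
  obtain r L where r: "r > 0" and L: "L-lipschitz_on (ball x r) j"
    using assms unfolding locally_lipschitz_def by blast
  have L0: "0 \<le> L" using L by (rule lipschitz_on_nonneg)
  have fst: "filterlim fst (nhds x) ?F" by (rule filterlim_fst)
  have snd: "filterlim snd (at_right 0) ?F" by (rule filterlim_snd)
  have snd0: "(snd \<longlongrightarrow> 0) ?F" using snd by (auto simp: filterlim_at)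
  have "((\<lambda>p. fst p + snd p *\<^sub>R v) \<longlongrightarrow> x + 0 *\<^sub>R v) ?F"
    by (intro tendsto_intros fst snd0)
  then have add: "((\<lambda>p. fst p + snd p *\<^sub>R v) \<longlongrightarrow> x) ?F" by simp
  have xb: "open (ball x r)" "x \<in> ball x r" using r by auto
  have e1: "\<forall>\<^sub>F p in ?F. fst p \<in> ball x r" using topological_tendstoD[OF fst xb] .
  have e2: "\<forall>\<^sub>F p in ?F. fst p + snd p *\<^sub>R v \<in> ball x r" using topological_tendstoD[OF add xb] .
  have e3: "\<forall>\<^sub>F p in ?F. 0 < snd p"
    using snd by (auto simp: filterlim_at elim: eventually_mono)
  have "\<forall>\<^sub>F p in ?F. ereal (- (L * norm v)) \<le> ?q p \<and> ?q p \<le> ereal (L * norm v)"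
    using e1 e2 e3
  proof eventually_elim
    case (elim p)
    obtain y l where p: "p = (y, l)" by force
    have "\<bar>j (y + l *\<^sub>R v) - j y\<bar> \<le> L * (l * norm v)"
      using lipschitz_onD[OF L elim(2) elim(1)] elim(3) p by (simp add: dist_norm)
    then have "\<bar>(j (y + l *\<^sub>R v) - j y) / l\<bar> \<le> L * norm v"
      using elim(3) p by (simp add: field_simps)
    then have "- (L * norm v) \<le> (j (y + l *\<^sub>R v) - j y) / l \<and> (j (y + l *\<^sub>R v) - j y) / l \<le> L * norm v"
      by linarith
    then show ?case using p by simp
  qed
  then have lo: "\<forall>\<^sub>F p in ?F. ereal (- (L * norm v)) \<le> ?q p"
    and hi: "\<forall>\<^sub>F p in ?F. ?q p \<le> ereal (L * norm v)"
    by (auto elim: eventually_mono)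
  have nt: "?F \<noteq> bot" by (simp add: prod_filter_eq_bot)
  have "Limsup ?F ?q \<le> ereal (L * norm v)" using hi by (rule Limsup_bounded)
  moreover have "ereal (- (L * norm v)) \<le> Limsup ?F ?q"
    using Liminf_bounded[OF lo] Liminf_le_Limsup[OF nt] order_trans by blast
  ultimately have "\<bar>Limsup ?F ?q\<bar> \<noteq> \<infinity>" by (cases "Limsup ?F ?q") auto
  then show ?thesis unfolding clarke_deriv_def by (rule ereal_real')
qed

text \<open>
  The explicit discretization of the history-dependent operator
  \<open>(S v)(t) = R (\<integral>\<^sub>0\<^sup>t q(t,s) v(s) ds + a\<^sub>S)\<close> on the grid \<open>t\<^sub>i = i k\<close>: the trapezoidal rule in which
  the last nodal value \<open>q(t\<^sub>n,t\<^sub>n) u\<^sub>n\<close> is replaced by \<open>q(t\<^sub>n,t\<^sub>n\<^sub>-\<^sub>1) u\<^sub>n\<^sub>-\<^sub>1\<close>. It is meant for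
  \<open>n \<ge> 1\<close> and uses only \<open>u 0, \<dots>, u (n - 1)\<close>.
\<close>

definition discrete_history ::
  "('x::real_normed_vector \<Rightarrow>\<^sub>L 'y::real_normed_vector) \<Rightarrow> (real \<Rightarrow> real \<Rightarrow> 'x \<Rightarrow>\<^sub>L 'x) \<Rightarrow> 'x \<Rightarrow>
    real \<Rightarrow> nat \<Rightarrow> (nat \<Rightarrow> 'x) \<Rightarrow> 'y" where
  "discrete_history R q a\<^sub>S k n u =
    (let t = (\<lambda>i. real i * k) in
      blinfun_apply R
        ((k / 2) *\<^sub>R blinfun_apply (q (t n) (t 0)) (u 0)
         + k *\<^sub>R (\<Sum>i = 1..<n. blinfun_apply (q (t n) (t i)) (u i))
         + (k / 2) *\<^sub>R blinfun_apply (q (t n) (t (n - 1))) (u (n - 1))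
         + a\<^sub>S))"

end

theory Submission
  imports Defs
begin

text \<open>
  The solution \<open>u n\<close> and an iterate satisfy two inequalities over the same convex set, so each may be used
  as the test element in the inequality of the other; adding the two eliminates \<open>f\<close>. Write \<open>a\<close> for
  the current iterate, \<open>b\<close> for the previous one and \<open>w\<close> for \<open>u n\<close>. Strong monotonicity of \<open>A\<close>
  bounds the sum from one side by \<open>m\<^sub>A \<parallel>a - w\<parallel>\<^sup>2\<close>. On the other side there remain the \<open>\<phi>\<close> terms,
  of size \<open>\<alpha>\<^sub>\<phi> \<parallel>b - w\<parallel> \<parallel>a - w\<parallel>\<close>, the Clarke derivatives of \<open>j\<close>, which may be as bad as
  \<open>\<alpha>\<^sub>j \<parallel>\<gamma>\<^sub>j a - \<gamma>\<^sub>j w\<parallel>\<^sup>2\<close>, and the pairing \<open>\<langle>j\<^sub>c (\<gamma>\<^sub>j a - \<gamma>\<^sub>j b), \<gamma>\<^sub>j w - \<gamma>\<^sub>j a\<rangle>\<close>.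

  The operator \<open>j\<^sub>c\<close> is chosen to absorb the lack of convexity of \<open>j\<close>: splitting \<open>a - b\<close> at \<open>w\<close>,
  coercivity of \<open>j\<^sub>c\<close> produces \<open>- \<alpha>\<^sub>j \<parallel>\<gamma>\<^sub>j a - \<gamma>\<^sub>j w\<parallel>\<^sup>2\<close>, which cancels the bound for \<open>j\<close>
  exactly, and what is left is at most \<open>\<alpha>\<^sub>c c\<^sub>j\<^sup>2 \<parallel>b - w\<parallel> \<parallel>a - w\<parallel>\<close>
  (lemma \<open>stabilised_nonconvexity_bound\<close>). Dividing by \<open>m\<^sub>A \<parallel>a - w\<parallel>\<close> gives the rate \<open>\<rho>\<close>.
  The discrete history enters only as one value, the same in both inequalities, so its difference
  vanishes and neither it nor the step size influences \<open>\<rho>\<close>. If \<open>\<rho> < 1\<close>, iterating the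
  estimate gives geometric decay of the error.
\<close>

text \<open>
  The sum of the two Clarke derivatives is bounded by the same square that coercivity of \<open>j\<^sub>c\<close>
  yields with the opposite sign. This cancellation is the reason for adding \<open>j\<^sub>c\<close> to the iteration.
\<close>

lemma stabilised_nonconvexity_bound:
  fixes j :: "'z::real_normed_vector \<Rightarrow> real" and j\<^sub>c :: "'z \<Rightarrow> ('z \<Rightarrow>\<^sub>L real)"
  assumes relaxed: "\<And>z1 z2.
      clarke_deriv j z1 (z2 - z1) + clarke_deriv j z2 (z1 - z2) \<le> \<alpha>\<^sub>j * (norm (z1 - z2))\<^sup>2"
    and lin: "linear j\<^sub>c"
    and bound: "\<And>z. norm (j\<^sub>c z) \<le> \<alpha>\<^sub>c * norm z"
    and coercive: "\<And>z. blinfun_apply (j\<^sub>c z) z \<ge> \<alpha>\<^sub>j * (norm z)\<^sup>2"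
  shows "clarke_deriv j w (a - w) + clarke_deriv j a (w - a)
      + blinfun_apply (j\<^sub>c a) (w - a) - blinfun_apply (j\<^sub>c b) (w - a)
    \<le> \<alpha>\<^sub>c * norm (b - w) * norm (a - w)"
proof -
  have "j\<^sub>c a - j\<^sub>c b = j\<^sub>c (w - b) - j\<^sub>c (w - a)"
    by (simp add: linear_diff[OF lin])
  then have split: "blinfun_apply (j\<^sub>c a) (w - a) - blinfun_apply (j\<^sub>c b) (w - a)
      = blinfun_apply (j\<^sub>c (w - b)) (w - a) - blinfun_apply (j\<^sub>c (w - a)) (w - a)"
    by (metis blinfun.diff_left)
  have "blinfun_apply (j\<^sub>c (w - b)) (w - a) \<le> norm (j\<^sub>c (w - b)) * norm (w - a)"
    using norm_blinfun[of "j\<^sub>c (w - b)" "w - a"] by simp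
  also have "\<dots> \<le> \<alpha>\<^sub>c * norm (w - b) * norm (w - a)"
    by (intro mult_right_mono bound) simp
  finally show ?thesis
    using split relaxed[of w a] coercive[of "w - a"] by (simp add: norm_minus_commute)
qed

text \<open>
  The estimate for one step, for an arbitrary value \<open>y\<close> of the history and an arbitrary functional
  \<open>g\<close> as right-hand side: both cancel when the inequalities are added.
\<close>

lemma stabilised_step_contraction:
  fixes \<gamma> :: "'x::real_normed_vector \<Rightarrow>\<^sub>L 'z::real_normed_vector"
    and A :: "'x \<Rightarrow> ('x \<Rightarrow>\<^sub>L real)"
    and \<phi> :: "'y::real_normed_vector \<Rightarrow> 'x \<Rightarrow> 'x \<Rightarrow> real"
    and j :: "'z \<Rightarrow> real" and j\<^sub>c :: "'z \<Rightarrow> ('z \<Rightarrow>\<^sub>L real)" and g :: "'x \<Rightarrow>\<^sub>L real"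
  assumes \<gamma>: "\<And>v. norm (blinfun_apply \<gamma> v) \<le> c * norm v" and "c \<ge> 0"
    and "m > 0"
    and mono: "\<And>v1 v2. blinfun_apply (A v1 - A v2) (v1 - v2) \<ge> m * (norm (v1 - v2))\<^sup>2"
    and "\<alpha>\<^sub>\<phi> \<ge> 0"
    and \<phi>: "\<And>u1 u2 v1 v2. u1 \<in> K \<Longrightarrow> u2 \<in> K \<Longrightarrow> v1 \<in> K \<Longrightarrow> v2 \<in> K \<Longrightarrow>
      \<phi> y u1 v2 - \<phi> y u1 v1 + \<phi> y u2 v1 - \<phi> y u2 v2 \<le> \<alpha>\<^sub>\<phi> * norm (u1 - u2) * norm (v1 - v2)"
    and relaxed: "\<And>z1 z2.
      clarke_deriv j z1 (z2 - z1) + clarke_deriv j z2 (z1 - z2) \<le> \<alpha>\<^sub>j * (norm (z1 - z2))\<^sup>2"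
    and lin: "linear j\<^sub>c" and "\<alpha>\<^sub>c \<ge> 0"
    and bound: "\<And>z. norm (j\<^sub>c z) \<le> \<alpha>\<^sub>c * norm z"
    and coercive: "\<And>z. blinfun_apply (j\<^sub>c z) z \<ge> \<alpha>\<^sub>j * (norm z)\<^sup>2"
    and "w \<in> K" "a \<in> K" "b \<in> K"
    and w: "\<And>v. v \<in> K \<Longrightarrow>
      blinfun_apply (A w) (v - w) + \<phi> y w v - \<phi> y w w
        + clarke_deriv j (blinfun_apply \<gamma> w) (blinfun_apply \<gamma> v - blinfun_apply \<gamma> w)
      \<ge> blinfun_apply g (v - w)"
    and a: "\<And>v. v \<in> K \<Longrightarrow>
      blinfun_apply (A a) (v - a) + \<phi> y b v - \<phi> y b a
        + clarke_deriv j (blinfun_apply \<gamma> a) (blinfun_apply \<gamma> v - blinfun_apply \<gamma> a)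
        + blinfun_apply (j\<^sub>c (blinfun_apply \<gamma> a)) (blinfun_apply \<gamma> v - blinfun_apply \<gamma> a)
      \<ge> blinfun_apply g (v - a)
        + blinfun_apply (j\<^sub>c (blinfun_apply \<gamma> b)) (blinfun_apply \<gamma> v - blinfun_apply \<gamma> a)"
  shows "norm (a - w) \<le> (\<alpha>\<^sub>\<phi> + \<alpha>\<^sub>c * c\<^sup>2) / m * norm (b - w)"
proof -
  let ?G = "blinfun_apply \<gamma>"
  have g0: "blinfun_apply g (a - w) + blinfun_apply g (w - a) = 0"
    by (simp add: blinfun.diff_right)
  have A: "m * (norm (a - w))\<^sup>2 \<le> - (blinfun_apply (A w) (a - w) + blinfun_apply (A a) (w - a))"
    using mono[of a w] by (simp add: blinfun.diff_left blinfun.diff_right)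
  have \<phi>': "\<phi> y w a - \<phi> y w w + \<phi> y b w - \<phi> y b a \<le> \<alpha>\<^sub>\<phi> * norm (b - w) * norm (a - w)"
    using \<phi>[of w b w a] \<open>w \<in> K\<close> \<open>a \<in> K\<close> \<open>b \<in> K\<close> by (simp add: norm_minus_commute)
  have \<gamma>_diff: "norm (?G x - ?G x') \<le> c * norm (x - x')" for x x'
    using \<gamma>[of "x - x'"] by (simp add: blinfun.diff_right)
  have "clarke_deriv j (?G w) (?G a - ?G w) + clarke_deriv j (?G a) (?G w - ?G a)
      + blinfun_apply (j\<^sub>c (?G a)) (?G w - ?G a) - blinfun_apply (j\<^sub>c (?G b)) (?G w - ?G a)
      \<le> \<alpha>\<^sub>c * norm (?G b - ?G w) * norm (?G a - ?G w)"
    by (rule stabilised_nonconvexity_bound[OF relaxed lin bound coercive])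
  also have "\<dots> \<le> \<alpha>\<^sub>c * (c * norm (b - w)) * (c * norm (a - w))"
    using \<open>\<alpha>\<^sub>c \<ge> 0\<close> \<open>c \<ge> 0\<close> by (intro mult_mono \<gamma>_diff) auto
  finally have "m * (norm (a - w))\<^sup>2
      \<le> \<alpha>\<^sub>\<phi> * norm (b - w) * norm (a - w) + \<alpha>\<^sub>c * (c * norm (b - w)) * (c * norm (a - w))"
    using A \<phi>' g0 w[OF \<open>a \<in> K\<close>] a[OF \<open>w \<in> K\<close>] by linarith
  then have sq: "m * norm (a - w) * norm (a - w)
      \<le> (\<alpha>\<^sub>\<phi> + \<alpha>\<^sub>c * c\<^sup>2) * norm (b - w) * norm (a - w)"
    by (simp add: power2_eq_square algebra_simps)
  have "m * norm (a - w) \<le> (\<alpha>\<^sub>\<phi> + \<alpha>\<^sub>c * c\<^sup>2) * norm (b - w)"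
  proof (cases "a = w")
    case True
    then show ?thesis using \<open>\<alpha>\<^sub>\<phi> \<ge> 0\<close> \<open>\<alpha>\<^sub>c \<ge> 0\<close> by simp
  next
    case False
    then show ?thesis using sq by simp
  qed
  then show ?thesis using \<open>m > 0\<close> by (simp add: field_simps)
qed

lemma tendsto_if_dist_contracts:
  fixes x :: "nat \<Rightarrow> 'a::metric_space"
  assumes "0 \<le> \<rho>" "\<rho> < 1" and step: "\<And>i. dist (x (Suc i)) l \<le> \<rho> * dist (x i) l"
  shows "x \<longlonglongrightarrow> l"
proof -
  have "dist (x i) l \<le> \<rho> ^ i * dist (x 0) l" for i
  proof (induction i)
    case (Suc i)
    show ?case
      using order_trans[OF step mult_left_mono[OF Suc \<open>0 \<le> \<rho>\<close>]] by (simp add: mult.assoc)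
  qed simp
  then have bound: "norm (dist (x i) l) \<le> \<rho> ^ i * dist (x 0) l" for i by simp
  have "(\<lambda>i. \<rho> ^ i * dist (x 0) l) \<longlonglongrightarrow> 0"
    using assms(1,2) by (intro tendsto_mult_left_zero LIMSEQ_power_zero) simp
  then have "(\<lambda>i. dist (x i) l) \<longlonglongrightarrow> 0"
    by (rule Lim_null_comparison[OF always_eventually[OF allI[OF bound]]])
  then show ?thesis by (rule iffD2[OF tendsto_dist_iff])
qed

theorem theorem26:
  fixes K :: "'x::banach set"
    and \<gamma>\<^sub>j :: "'x \<Rightarrow>\<^sub>L 'z::banach"
    and A :: "'x \<Rightarrow> ('x \<Rightarrow>\<^sub>L real)"
    and \<phi> :: "'y::real_normed_vector \<Rightarrow> 'x \<Rightarrow> 'x \<Rightarrow> real"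
    and j :: "'z \<Rightarrow> real"
    and f :: "real \<Rightarrow> ('x \<Rightarrow>\<^sub>L real)"
    and R :: "'x \<Rightarrow>\<^sub>L 'y"
    and q :: "real \<Rightarrow> real \<Rightarrow> ('x \<Rightarrow>\<^sub>L 'x)"
    and a\<^sub>S :: "'x"
    and j\<^sub>c :: "'z \<Rightarrow> ('z \<Rightarrow>\<^sub>L real)"
    and L\<^sub>A m\<^sub>A c\<^sub>j \<alpha>\<^sub>\<phi> \<beta>\<^sub>\<phi> c\<^sub>0 c\<^sub>1 \<alpha>\<^sub>j \<alpha>\<^sub>c T k :: real
    and N n :: nat
    and u u' :: "nat \<Rightarrow> 'x"
  assumes X_reflexive: "reflexive_space TYPE('x)"
    and K_closed: "closed K" and K_convex: "convex K" and K_zero: "0 \<in> K"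
    and c\<^sub>j_pos: "c\<^sub>j > 0"
    and \<gamma>\<^sub>j_bound: "\<forall>v. norm (blinfun_apply \<gamma>\<^sub>j v) \<le> c\<^sub>j * norm v"
    and L\<^sub>A_pos: "L\<^sub>A > 0" and A_lipschitz: "L\<^sub>A-lipschitz_on UNIV A"
    and m\<^sub>A_pos: "m\<^sub>A > 0"
    and A_strongly_monotone:
      "\<forall>v1 v2. blinfun_apply (A v1 - A v2) (v1 - v2) \<ge> m\<^sub>A * (norm (v1 - v2))\<^sup>2"
    and \<phi>_convex: "\<forall>y. \<forall>w\<in>K. convex_on K (\<phi> y w)"
    and \<phi>_lsc: "\<forall>y. \<forall>w\<in>K. lsc_on K (\<phi> y w)"
    and \<alpha>\<^sub>\<phi>_pos: "\<alpha>\<^sub>\<phi> > 0" and \<beta>\<^sub>\<phi>_pos: "\<beta>\<^sub>\<phi> > 0"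
    and \<phi>_bound: "\<forall>y1 y2. \<forall>u1\<in>K. \<forall>u2\<in>K. \<forall>v1\<in>K. \<forall>v2\<in>K.
      \<phi> y1 u1 v2 - \<phi> y1 u1 v1 + \<phi> y2 u2 v1 - \<phi> y2 u2 v2
        \<le> \<alpha>\<^sub>\<phi> * norm (u1 - u2) * norm (v1 - v2) + \<beta>\<^sub>\<phi> * norm (y1 - y2) * norm (v1 - v2)"
    and j_locally_lipschitz: "locally_lipschitz j"
    and c\<^sub>0_nonneg: "c\<^sub>0 \<ge> 0" and c\<^sub>1_nonneg: "c\<^sub>1 \<ge> 0"
    and j_growth: "\<forall>z. \<forall>\<xi>\<in>clarke_subdiff j z. norm \<xi> \<le> c\<^sub>0 + c\<^sub>1 * norm z"
    and \<alpha>\<^sub>j_pos: "\<alpha>\<^sub>j > 0"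
    and j_relaxed_monotone: "\<forall>z1 z2.
      clarke_deriv j z1 (z2 - z1) + clarke_deriv j z2 (z1 - z2) \<le> \<alpha>\<^sub>j * (norm (z1 - z2))\<^sup>2"
    and f_continuous: "continuous_on {0..} f"
    and q_continuous: "continuous_on ({0..} \<times> {0..}) (\<lambda>(t, s). q t s)"
    and smallness: "\<alpha>\<^sub>\<phi> + \<alpha>\<^sub>j * c\<^sub>j\<^sup>2 < m\<^sub>A"
    and j\<^sub>c_linear: "linear j\<^sub>c"
    and \<alpha>\<^sub>c_nonneg: "\<alpha>\<^sub>c \<ge> 0"
    and j\<^sub>c_bound: "\<forall>z. norm (j\<^sub>c z) \<le> \<alpha>\<^sub>c * norm z"
    and j\<^sub>c_coercive: "\<forall>z. blinfun_apply (j\<^sub>c z) z \<ge> \<alpha>\<^sub>j * (norm z)\<^sup>2"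
    and T_pos: "T > 0" and N_pos: "N > 0" and k_def: "k = T / real N"
    and n_ge: "1 \<le> n" and n_le: "n \<le> N"
    and u_in: "\<forall>i\<le>n. u i \<in> K"
    and u_solution: "\<forall>v\<in>K.
      blinfun_apply (A (u n)) (v - u n)
        + \<phi> (discrete_history R q a\<^sub>S k n u) (u n) v
        - \<phi> (discrete_history R q a\<^sub>S k n u) (u n) (u n)
        + clarke_deriv j (blinfun_apply \<gamma>\<^sub>j (u n)) (blinfun_apply \<gamma>\<^sub>j v - blinfun_apply \<gamma>\<^sub>j (u n))
      \<ge> blinfun_apply (f (real n * k)) (v - u n)"
    and u'_in: "\<forall>i. u' i \<in> K"
    and u'_iteration: "\<forall>i\<ge>1. \<forall>v\<in>K.
      blinfun_apply (A (u' i)) (v - u' i)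
        + \<phi> (discrete_history R q a\<^sub>S k n u) (u' (i - 1)) v
        - \<phi> (discrete_history R q a\<^sub>S k n u) (u' (i - 1)) (u' i)
        + clarke_deriv j (blinfun_apply \<gamma>\<^sub>j (u' i)) (blinfun_apply \<gamma>\<^sub>j v - blinfun_apply \<gamma>\<^sub>j (u' i))
        + blinfun_apply (j\<^sub>c (blinfun_apply \<gamma>\<^sub>j (u' i)))
            (blinfun_apply \<gamma>\<^sub>j v - blinfun_apply \<gamma>\<^sub>j (u' i))
      \<ge> blinfun_apply (f (real n * k)) (v - u' i)
        + blinfun_apply (j\<^sub>c (blinfun_apply \<gamma>\<^sub>j (u' (i - 1))))
            (blinfun_apply \<gamma>\<^sub>j v - blinfun_apply \<gamma>\<^sub>j (u' i))"
  shows "let \<rho> = (\<alpha>\<^sub>\<phi> + \<alpha>\<^sub>c * c\<^sub>j\<^sup>2) / m\<^sub>A in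
    (\<forall>i\<ge>1. norm (u' i - u n) \<le> \<rho> * norm (u' (i - 1) - u n)) \<and>
    (\<rho> < 1 \<longrightarrow> u' \<longlonglongrightarrow> u n)"
proof -
  define \<rho> where "\<rho> = (\<alpha>\<^sub>\<phi> + \<alpha>\<^sub>c * c\<^sub>j\<^sup>2) / m\<^sub>A"
  let ?y = "discrete_history R q a\<^sub>S k n u"
  \<comment> \<open>Both inequalities contain the same history value, so the \<open>\<beta>\<^sub>\<phi>\<close> term is zero.\<close>
  have \<phi>: "\<phi> ?y u1 v2 - \<phi> ?y u1 v1 + \<phi> ?y u2 v1 - \<phi> ?y u2 v2
      \<le> \<alpha>\<^sub>\<phi> * norm (u1 - u2) * norm (v1 - v2)"
    if "u1 \<in> K" "u2 \<in> K" "v1 \<in> K" "v2 \<in> K" for u1 u2 v1 v2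
  proof -
    have "\<phi> ?y u1 v2 - \<phi> ?y u1 v1 + \<phi> ?y u2 v1 - \<phi> ?y u2 v2
        \<le> \<alpha>\<^sub>\<phi> * norm (u1 - u2) * norm (v1 - v2) + \<beta>\<^sub>\<phi> * norm (?y - ?y) * norm (v1 - v2)"
      using \<phi>_bound that by blast
    then show ?thesis by simp
  qed
  have step: "norm (u' i - u n) \<le> \<rho> * norm (u' (i - 1) - u n)" if "i \<ge> 1" for i
    unfolding \<rho>_def
  proof (rule stabilised_step_contraction
      [where \<gamma> = \<gamma>\<^sub>j and A = A and \<phi> = \<phi> and y = ?y and K = K and j = j and \<alpha>\<^sub>j = \<alpha>\<^sub>j
        and j\<^sub>c = j\<^sub>c and g = "f (real n * k)"])
    show "u n \<in> K" "u' i \<in> K" "u' (i - 1) \<in> K"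
      using u_in u'_in by auto
  qed (fact \<gamma>\<^sub>j_bound[rule_format] less_imp_le[OF c\<^sub>j_pos] m\<^sub>A_pos A_strongly_monotone[rule_format]
      less_imp_le[OF \<alpha>\<^sub>\<phi>_pos] \<phi> j_relaxed_monotone[rule_format] j\<^sub>c_linear \<alpha>\<^sub>c_nonneg
      j\<^sub>c_bound[rule_format] j\<^sub>c_coercive[rule_format] u_solution[rule_format]
      u'_iteration[rule_format, OF that])+
  have "u' \<longlonglongrightarrow> u n" if "\<rho> < 1"
  proof (rule tendsto_if_dist_contracts[OF _ that])
    show "0 \<le> \<rho>" using \<alpha>\<^sub>\<phi>_pos \<alpha>\<^sub>c_nonneg m\<^sub>A_pos by (simp add: \<rho>_def)
    show "dist (u' (Suc i)) (u n) \<le> \<rho> * dist (u' i) (u n)" for i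
      using step[of "Suc i"] by (simp add: dist_norm)
  qed
  with step show ?thesis unfolding Let_def \<rho>_def[symmetric] by blast
qed

end
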